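(* Let $0<p_1<p_2<1$, and let $F$ and $G$ be any two cdf's. Then $$\int_{p_1}^{p_2} \big( G^{-1}(u)-F^{-1}(u) \big)\, du =\int_{F^{-1}(p_1)}^{F^{-1}(p_2)} \big( F(x)- G(x)\big)\, dx + \mathrm{Rem}(p_2;F,G)-\mathrm{Rem}(p_1;F,G),$$ where, for $p\in\{p_1,p_2\}$, the remainder term $$\mathrm{Rem}(p;F,G) =\int^{F^{-1}(p)}_{G^{-1}(p)} \big( G(x)-p\big)\, dx$$ is non-negative and satisfies the bounds $$\mathrm{Rem}(p;F,G) \le \int^{F^{-1}(p)}_{G^{-1}(p)} \big( G(x) - F(x)\big)\, dx \le \big| G^{-1}(p)-F^{-1}(p)\big|\,\sup_{x\in \mathbb{R}} \big| G(x) - F(x)\big| .$$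
   Context: A cdf is the cumulative distribution function $F(x)=\mathbb{P}(X\le x)$ of a real-valued random variable. The quantile function of a cdf $F$ is $F^{-1}(u)=\inf\{x\in\mathbb{R}: F(x)\ge u\}$ for $u\in(0,1]$ and $F^{-1}(0)=\lim_{u\downarrow 0}F^{-1}(u)$. Integrals are oriented: $\int_a^b=-\int_b^a$ when $a>b$. *)

theory Defs
  imports "HOL-Probability.Probability"
begin

text \<open>
  A real distribution is the law of a real random variable; the lemma below gives the
  version with an explicit random variable.
\<close>

definition is_cdf :: "(real \<Rightarrow> real) \<Rightarrow> bool" where
  "is_cdf F \<longleftrightarrow> (\<exists>M. real_distribution M \<and> F = cdf M)"

lemma is_cdf_random_variable:
  assumes "prob_space M" and "X \<in> borel_measurable M"
  shows "is_cdf (\<lambda>x. measure M {\<omega> \<in> space M. X \<omega> \<le> x})"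
proof -
  interpret prob_space M by fact
  have "real_distribution (distr M borel X)"
    using assms(2) by (rule real_distribution_distr)
  moreover have "(\<lambda>x. measure M {\<omega> \<in> space M. X \<omega> \<le> x}) = cdf (distr M borel X)"
    using assms(2)
    by (auto simp: cdf_def measure_distr fun_eq_iff intro!: arg_cong[where f = "measure M"])
  ultimately show ?thesis unfolding is_cdf_def by blast
qed

text \<open>
  The values are extended reals because \<open>F\<^sup>-\<^sup>1(0)\<close> and \<open>F\<^sup>-\<^sup>1(1)\<close> may be infinite.
  Arguments outside the unit interval are irrelevant.
\<close>

definition quantile :: "(real \<Rightarrow> real) \<Rightarrow> real \<Rightarrow> ereal" where
  "quantile F u =
     (if u = 0 then Lim (at_right 0) (\<lambda>v. INF x\<in>{x. v \<le> F x}. ereal x)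
      else INF x\<in>{x. u \<le> F x}. ereal x)"

lemma quantile_finite:
  assumes "is_cdf F" and "0 < u" and "u < 1"
  shows "\<bar>quantile F u\<bar> \<noteq> \<infinity>"
proof -
  obtain M where M: "real_distribution M" "F = cdf M"
    using assms(1) unfolding is_cdf_def by blast
  interpret real_distribution M by (rule M(1))
  have "\<forall>\<^sub>F x in at_top. u < F x"
    unfolding M(2) using cdf_lim_at_top_prob assms(3) by (rule order_tendstoD)
  then obtain b where b: "u < F b"
    by (metis eventually_at_top_linorder order_refl)
  have "\<forall>\<^sub>F x in at_bot. F x < u"
    unfolding M(2) using cdf_lim_at_bot assms(2) by (rule order_tendstoD)
  then obtain a where a: "F a < u"
    by (metis eventually_at_bot_linorder order_refl)
  have "a \<le> x" if "u \<le> F x" for x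
    using that a cdf_nondecreasing[of x a] unfolding M(2) by linarith
  then have "ereal a \<le> quantile F u"
    using assms(2) by (auto simp: quantile_def intro!: INF_greatest)
  moreover have "quantile F u \<le> ereal b"
    using assms(2) b by (auto simp: quantile_def intro!: INF_lower)
  ultimately show ?thesis by auto
qed

text \<open>The interval integral is oriented, as needed when \<open>F\<^sup>-\<^sup>1(p) < G\<^sup>-\<^sup>1(p)\<close>.\<close>

definition Rem :: "real \<Rightarrow> (real \<Rightarrow> real) \<Rightarrow> (real \<Rightarrow> real) \<Rightarrow> real" where
  "Rem p F G = (LBINT x=quantile G p..quantile F p. G x - p)"

end

theory Submission
  imports Defs
begin

text \<open>
  For \<open>p \<le> u \<le> r\<close> the quantile function satisfies \<open>H\<^sup>-\<^sup>1(u) \<le> x \<longleftrightarrow> u \<le> H(x)\<close>, so the region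
  \<open>{(x, u). H(x) < u}\<close> has sections of length \<open>H\<^sup>-\<^sup>1(u) - H\<^sup>-\<^sup>1(p)\<close> in one direction and
  \<open>r - H(x)\<close> in the other. Fubini's theorem then gives the integration by parts formula
  \<open>\<integral>\<^sub>p\<^sup>r H\<^sup>-\<^sup>1 = r H\<^sup>-\<^sup>1(r) - p H\<^sup>-\<^sup>1(p) - \<integral> H\<close>, the last integral running from \<open>H\<^sup>-\<^sup>1(p)\<close> to
  \<open>H\<^sup>-\<^sup>1(r)\<close>. Subtracting it for \<open>F\<close> from that for \<open>G\<close> and moving the limits of integration of
  \<open>G\<close> to those of \<open>F\<close> produces the remainders. Their bounds come from pointwise comparison
  of the integrands, whose signs the same equivalence determines.
\<close>

lemma is_cdfD:
  assumes "is_cdf H"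
  shows is_cdf_mono: "mono H"
    and is_cdf_right_cont: "continuous (at_right x) H"
    and is_cdf_nonneg: "0 \<le> H x"
    and is_cdf_le_1: "H x \<le> 1"
    and is_cdf_measurable: "H \<in> borel_measurable borel"
proof -
  obtain M where M: "real_distribution M" "H = cdf M"
    using assms unfolding is_cdf_def by blast
  interpret real_distribution M by (rule M(1))
  show "mono H"
    unfolding M(2) by (simp add: monoI cdf_nondecreasing)
  then show "H \<in> borel_measurable borel"
    by (rule borel_measurable_mono)
  show "continuous (at_right x) H"
    unfolding M(2) by (rule cdf_is_right_cont)
  show "0 \<le> H x" "H x \<le> 1"
    unfolding M(2) by (simp_all add: cdf_nonneg cdf_bounded_prob)
qed

text \<open>Right continuity makes the infimum attained. Every \<open>y > x\<close> lies above some
  \<open>z\<close> with \<open>u \<le> H z\<close>, so \<open>u \<le> H y\<close> by monotonicity,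
  and letting \<open>y\<close> decrease to \<open>x\<close> gives
  \<open>u \<le> H x\<close>.\<close>

lemma quantile_le_iff:
  assumes "is_cdf H" and "0 < u"
  shows "quantile H u \<le> ereal x \<longleftrightarrow> u \<le> H x"
proof
  assume le: "quantile H u \<le> ereal x"
  have "u \<le> H y" if "x < y" for y
  proof -
    have "(INF z\<in>{z. u \<le> H z}. ereal z) < ereal y"
      using le that \<open>0 < u\<close> by (simp add: quantile_def le_less_trans)
    then obtain z where "u \<le> H z" "z < y"
      unfolding INF_less_iff by auto
    then show ?thesis
      using monoD[OF is_cdf_mono[OF assms(1)], of z y] by simp
  qed
  then have "\<forall>\<^sub>F y in at_right x. u \<le> H y"
    by (rule eventually_mono[OF eventually_at_right_less])
  moreover have "(H \<longlongrightarrow> H x) (at_right x)"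
    using is_cdf_right_cont[OF assms(1)] by (simp add: continuous_within)
  ultimately show "u \<le> H x"
    using trivial_limit_at_right_real tendsto_lowerbound by blast
qed (use \<open>0 < u\<close> in \<open>auto simp: quantile_def intro: INF_lower\<close>)

lemma integral_generalized_inverse:
  fixes H q :: "real \<Rightarrow> real"
  assumes "p \<le> r" and [measurable]: "H \<in> borel_measurable borel"
    and galois: "\<And>u x. p \<le> u \<Longrightarrow> u \<le> r \<Longrightarrow> q u \<le> x \<longleftrightarrow> u \<le> H x"
    and int_H: "set_integrable lborel {q p..<q r} H"
  shows "set_integrable lborel {p..r} q"
    and "(LBINT u:{p..r}. q u) = r * q r - p * q p - (LBINT x:{q p..<q r}. H x)"
proof -
  \<comment> \<open>The cut-off to a bounded rectangle makes the indicator of \<open>R\<close>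
    integrable. The range of \<open>x\<close> is half-open because \<open>x < q r\<close> is
    equivalent to \<open>H x < r\<close>, so every vertical section is the nonempty interval
    \<open>{H x<..r}\<close>.\<close>
  define R where "R = {(x, u). x \<in> {q p..<q r} \<and> u \<in> {p..r} \<and> H x < u}"
  have q_mono: "q u \<le> q v" if "p \<le> u" "u \<le> v" "v \<le> r" for u v
    using galois[of v "q v"] galois[of u "q v"] that by simp
  have "R = {z \<in> space (lborel \<Otimes>\<^sub>M lborel).
      q p \<le> fst z \<and> fst z < q r \<and> p \<le> snd z \<and> snd z \<le> r \<and> H (fst z) < snd z}"
    by (auto simp: R_def space_pair_measure)
  also have "\<dots> \<in> sets (lborel \<Otimes>\<^sub>M lborel)"
    by measurable
  finally have R_sets: "R \<in> sets (lborel \<Otimes>\<^sub>M lborel)" .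
  have "R \<subseteq> {q p..q r} \<times> {p..r}"
    unfolding R_def by auto
  then have "emeasure (lborel \<Otimes>\<^sub>M lborel) R \<le> emeasure (lborel \<Otimes>\<^sub>M lborel) ({q p..q r} \<times> {p..r})"
    by (intro emeasure_mono) auto
  also have "\<dots> < \<infinity>"
    by (simp add: lborel.emeasure_pair_measure_Times emeasure_lborel_Icc_eq ennreal_mult_less_top)
  finally have int: "integrable (lborel \<Otimes>\<^sub>M lborel) (\<lambda>(x, u). indicator R (x, u) :: real)"
    using R_sets by (simp add: split_beta' integrable_real_indicator)
  have u_section: "(LBINT x. indicator R (x, u)) = indicator {p..r} u * (q u - q p)" for u
  proof (cases "u \<in> {p..r}")
    case True
    then have "indicator R (x, u) = (indicator {q p..<q u} x :: real)" for x
      using galois[of u x] q_mono[of u r] by (auto simp: R_def indicator_def)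
    then show ?thesis
      using True q_mono[of p u] by simp
  next
    case False
    then have "indicator R (x, u) = (0 :: real)" for x
      by (auto simp: R_def)
    with False show ?thesis by simp
  qed
  have x_section: "(LBINT u. indicator R (x, u)) = indicator {q p..<q r} x * (r - H x)" for x
  proof (cases "x \<in> {q p..<q r}")
    case True
    then have "p \<le> H x" "H x < r"
      using galois[of p x] galois[of r x] \<open>p \<le> r\<close> by auto
    moreover from this True have "indicator R (x, u) = (indicator {H x<..r} u :: real)" for u
      by (auto simp: R_def indicator_def)
    ultimately show ?thesis
      using True by simp
  next
    case False
    then have "indicator R (x, u) = (0 :: real)" for u
      by (auto simp: R_def)
    with False show ?thesis by simp
  qed
  \<comment> \<open>Fubini's theorem also makes the section lengths integrable, and these are
    \<open>q u - q p\<close>. Adding the constant \<open>q p\<close> back gives the integrability of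
    \<open>q\<close>.\<close>
  have int_diff: "set_integrable lborel {p..r} (\<lambda>u. q u - q p)"
    using lborel_pair.integrable_snd[OF int] by (simp add: u_section set_integrable_def)
  have int_const: "set_integrable lborel {p..r} (\<lambda>_. q p)"
    by (simp add: set_integrable_def integrable_indicator_iff emeasure_lborel_Icc_eq)
  from set_integral_add(1)[OF int_diff int_const]
  show int_q: "set_integrable lborel {p..r} q" by simp
  have "(LBINT u:{p..r}. q u) - (r - p) * q p = (LBINT u:{p..r}. q u - q p)"
    using \<open>p \<le> r\<close> by (subst set_integral_diff(2)[OF int_q int_const])
      (simp add: set_lebesgue_integral_def)
  also have "\<dots> = (LBINT x:{q p..<q r}. r - H x)"
    using lborel_pair.Fubini_integral[OF int]
    by (simp add: u_section x_section set_lebesgue_integral_def)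
  also have "\<dots> = (q r - q p) * r - (LBINT x:{q p..<q r}. H x)"
    using q_mono[of p r] \<open>p \<le> r\<close> int_H
    by (subst set_integral_diff(2)) (simp_all add: set_integrable_def set_lebesgue_integral_def)
  finally show "(LBINT u:{p..r}. q u) = r * q r - p * q p - (LBINT x:{q p..<q r}. H x)"
    by (simp add: algebra_simps)
qed

lemma interval_integrable_bounded:
  fixes f :: "real \<Rightarrow> real"
  assumes [measurable]: "f \<in> borel_measurable borel" and "\<And>x. \<bar>f x\<bar> \<le> B"
  shows "interval_lebesgue_integrable lborel (ereal a) (ereal b) f"
proof -
  have "set_integrable lborel (einterval (ereal c) (ereal d)) f" for c d
    unfolding set_integrable_def
    by (rule integrableI_bounded_set_indicator[where B = B])
      (use assms(2) in \<open>auto simp: emeasure_bounded_finite[unfolded infinity_ennreal_def]\<close>)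
  then show ?thesis
    by (simp add: interval_lebesgue_integrable_def)
qed

text \<open>Swapping the endpoints changes the sign of an oriented integral, so on a reversed
  interval the opposite pointwise inequality is the right one. This treats both possible orders of
  the two quantiles at once.\<close>

lemma interval_integral_le_signed:
  fixes f g :: "real \<Rightarrow> real"
  assumes f: "interval_lebesgue_integrable lborel (ereal a) (ereal b) f"
    and g: "interval_lebesgue_integrable lborel (ereal a) (ereal b) g"
    and up: "\<And>x. a < x \<Longrightarrow> x < b \<Longrightarrow> f x \<le> g x"
    and down: "\<And>x. b < x \<Longrightarrow> x < a \<Longrightarrow> g x \<le> f x"
  shows "(LBINT x=ereal a..ereal b. f x) \<le> (LBINT x=ereal a..ereal b. g x)"
proof (cases "a \<le> b")
  case True
  with f g up show ?thesis
    by (auto simp: interval_lebesgue_integral_def interval_lebesgue_integrable_def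
        intro!: set_integral_mono)
next
  case False
  with f g down show ?thesis
    by (auto simp: interval_lebesgue_integral_def interval_lebesgue_integrable_def
        intro!: set_integral_mono)
qed

theorem theorem6p1:
  fixes p\<^sub>1 p\<^sub>2 :: real and F G :: "real \<Rightarrow> real"
  assumes "0 < p\<^sub>1" and "p\<^sub>1 < p\<^sub>2" and "p\<^sub>2 < 1"
    and "is_cdf F" and "is_cdf G"
  shows "(LBINT u=p\<^sub>1..p\<^sub>2. real_of_ereal (quantile G u) - real_of_ereal (quantile F u))
       = (LBINT x=quantile F p\<^sub>1..quantile F p\<^sub>2. F x - G x) + Rem p\<^sub>2 F G - Rem p\<^sub>1 F G
     \<and> (\<forall>p\<in>{p\<^sub>1, p\<^sub>2}.
          0 \<le> Rem p F G
        \<and> Rem p F G \<le> (LBINT x=quantile G p..quantile F p. G x - F x)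
        \<and> (LBINT x=quantile G p..quantile F p. G x - F x)
          \<le> \<bar>real_of_ereal (quantile G p) - real_of_ereal (quantile F p)\<bar>
            * (SUP x::real. \<bar>G x - F x\<bar>))"
proof -
  \<comment> \<open>Quantiles are finite strictly between levels 0 and 1, so the computation can be
    done with the real-valued \<open>q\<close>.\<close>
  define q where "q H u = real_of_ereal (quantile H u)" for H u
  have quantile: "quantile H u = ereal (q H u)" if "is_cdf H" "0 < u" "u < 1" for H u
    using quantile_finite[OF that] by (simp add: q_def ereal_real)
  have galois: "q H u \<le> x \<longleftrightarrow> u \<le> H x" if "is_cdf H" "0 < u" "u < 1" for H u x
    using quantile_le_iff[OF that(1,2), of x] quantile[OF that] by simp
  note [measurable] = is_cdf_measurable[OF assms(4)] is_cdf_measurable[OF assms(5)]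
  have abs_le: "\<bar>H x\<bar> \<le> 1" if "is_cdf H" for H x
    using is_cdf_nonneg[OF that, of x] is_cdf_le_1[OF that, of x] by simp
  have int_cdf: "interval_lebesgue_integrable lborel (ereal a) (ereal b) H" if "is_cdf H" for H a b
    using is_cdf_measurable[OF that] abs_le[OF that] by (rule interval_integrable_bounded)
  \<comment> \<open>This bound gives integrability on bounded intervals and, later, makes the real
    supremum of \<open>\<bar>G x - F x\<bar>\<close> a genuine upper bound.\<close>
  have diff_le: "\<bar>G x - F x\<bar> \<le> 1" for x
    using is_cdf_nonneg[OF assms(4), of x] is_cdf_le_1[OF assms(4), of x]
      is_cdf_nonneg[OF assms(5), of x] is_cdf_le_1[OF assms(5), of x] by linarith
  have int_diff: "interval_lebesgue_integrable lborel (ereal a) (ereal b) (\<lambda>x. G x - F x)" for a b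
    using diff_le by (intro interval_integrable_bounded) auto
  have int_const: "interval_lebesgue_integrable lborel (ereal a) (ereal b) (\<lambda>_. c)" for a b c :: real
    by (rule interval_integrable_bounded[where B = "\<bar>c\<bar>"]) auto

  have parts: "interval_lebesgue_integrable lborel p\<^sub>1 p\<^sub>2 (q H)"
      "(LBINT u=p\<^sub>1..p\<^sub>2. q H u) = p\<^sub>2 * q H p\<^sub>2 - p\<^sub>1 * q H p\<^sub>1 - (LBINT x=q H p\<^sub>1..q H p\<^sub>2. H x)"
    if H: "is_cdf H" for H
  proof -
    have le: "q H p\<^sub>1 \<le> q H p\<^sub>2"
      using galois[OF H, of p\<^sub>1 "q H p\<^sub>2"] galois[OF H, of p\<^sub>2 "q H p\<^sub>2"] assms(1-3) by simp
    have "set_integrable lborel {q H p\<^sub>1..<q H p\<^sub>2} H"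
      unfolding set_integrable_def
      by (rule integrableI_bounded_set_indicator[where B = 1])
        (use abs_le[OF H] is_cdf_measurable[OF H] in \<open>auto simp: emeasure_bounded_finite[unfolded infinity_ennreal_def]\<close>)
    note * = integral_generalized_inverse[of p\<^sub>1 p\<^sub>2 H "q H", OF _ is_cdf_measurable[OF H] _ this]
    have "set_integrable lborel {p\<^sub>1..p\<^sub>2} (q H)"
      using assms(1-3) galois[OF H] by (intro *(1)) auto
    then have "set_integrable lborel (einterval p\<^sub>1 p\<^sub>2) (q H)"
      by (rule set_integrable_subset) auto
    then show "interval_lebesgue_integrable lborel p\<^sub>1 p\<^sub>2 (q H)"
      using assms(2) by (simp add: interval_lebesgue_integrable_def)
    have "(LBINT u:{p\<^sub>1..p\<^sub>2}. q H u)
        = p\<^sub>2 * q H p\<^sub>2 - p\<^sub>1 * q H p\<^sub>1 - (LBINT x:{q H p\<^sub>1..<q H p\<^sub>2}. H x)"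
      using assms(1-3) galois[OF H] by (intro *(2)) auto
    then show "(LBINT u=p\<^sub>1..p\<^sub>2. q H u)
        = p\<^sub>2 * q H p\<^sub>2 - p\<^sub>1 * q H p\<^sub>1 - (LBINT x=q H p\<^sub>1..q H p\<^sub>2. H x)"
      using assms(2) by (simp add: interval_integral_Icc[of p\<^sub>1 p\<^sub>2] interval_integral_Ico[OF le])
  qed

  have Rem: "Rem p F G = (LBINT x=q G p..q F p. G x - p)" if "0 < p" "p < 1" for p
    unfolding Rem_def using that assms(4,5) by (simp add: quantile)
  have Rem_eq: "Rem p F G = (LBINT x=q G p..q F p. G x) - p * (q F p - q G p)"
    if "0 < p" "p < 1" for p
    unfolding Rem[OF that] interval_lebesgue_integral_diff(2)[OF int_cdf[OF assms(5)] int_const]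
    by (simp add: interval_integral_const)
  have split: "(LBINT x=ereal a..ereal b. G x) + (LBINT x=ereal b..ereal c. G x)
      = (LBINT x=ereal a..ereal c. G x)" for a b c
    by (rule interval_integral_sum)
      (simp only: ereal_min[symmetric] ereal_max[symmetric] int_cdf[OF assms(5)])
  have "(LBINT u=p\<^sub>1..p\<^sub>2. q G u - q F u)
      = (LBINT u=p\<^sub>1..p\<^sub>2. q G u) - (LBINT u=p\<^sub>1..p\<^sub>2. q F u)"
    by (rule interval_lebesgue_integral_diff(2)[OF parts(1)[OF assms(5)] parts(1)[OF assms(4)]])
  moreover have "(LBINT x=q F p\<^sub>1..q F p\<^sub>2. F x - G x)
      = (LBINT x=q F p\<^sub>1..q F p\<^sub>2. F x) - (LBINT x=q F p\<^sub>1..q F p\<^sub>2. G x)"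
    by (rule interval_lebesgue_integral_diff(2)[OF int_cdf[OF assms(4)] int_cdf[OF assms(5)]])
  \<comment> \<open>The integral of \<open>G\<close> from \<open>q G p\<^sub>1\<close> to
    \<open>q F p\<^sub>2\<close> is split once at \<open>q F p\<^sub>1\<close> and once at
    \<open>q G p\<^sub>2\<close>. Equating the two sums changes the limits of \<open>G\<close>, and
    the boundary terms \<open>p * q H p\<close> are absorbed by the constant parts of the
    remainders.\<close>
  ultimately have "(LBINT u=p\<^sub>1..p\<^sub>2. q G u - q F u)
      = (LBINT x=q F p\<^sub>1..q F p\<^sub>2. F x - G x) + Rem p\<^sub>2 F G - Rem p\<^sub>1 F G"
    using parts(2)[OF assms(4)] parts(2)[OF assms(5)] Rem_eq[of p\<^sub>1] Rem_eq[of p\<^sub>2] assms(1-3)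
      split[of "q G p\<^sub>1" "q F p\<^sub>1" "q F p\<^sub>2"] split[of "q G p\<^sub>1" "q G p\<^sub>2" "q F p\<^sub>2"]
    by (simp add: algebra_simps)
  then have "(LBINT u=p\<^sub>1..p\<^sub>2. real_of_ereal (quantile G u) - real_of_ereal (quantile F u))
      = (LBINT x=quantile F p\<^sub>1..quantile F p\<^sub>2. F x - G x) + Rem p\<^sub>2 F G - Rem p\<^sub>1 F G"
    using assms by (simp add: quantile flip: q_def)
  moreover have "0 \<le> Rem p F G
        \<and> Rem p F G \<le> (LBINT x=quantile G p..quantile F p. G x - F x)
        \<and> (LBINT x=quantile G p..quantile F p. G x - F x)
          \<le> \<bar>real_of_ereal (quantile G p) - real_of_ereal (quantile F p)\<bar>
            * (SUP x::real. \<bar>G x - F x\<bar>)" if "p \<in> {p\<^sub>1, p\<^sub>2}" for p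
  proof -
    have p: "0 < p" "p < 1"
      using that assms(1-3) by auto
    note gal = galois[OF assms(4) p] galois[OF assms(5) p]
    have int_Gp: "interval_lebesgue_integrable lborel (q G p) (q F p) (\<lambda>x. G x - p)"
      by (rule interval_lebesgue_integral_diff(1)[OF int_cdf[OF assms(5)] int_const])
    \<comment> \<open>To the right of \<open>q G p\<close> one has \<open>p \<le> G x\<close>, to
      its left \<open>G x < p\<close>, so the sign of the integrand always agrees with the
      orientation.\<close>
    have "(LBINT x=q G p..q F p. 0) \<le> (LBINT x=q G p..q F p. G x - p)"
      by (rule interval_integral_le_signed[OF int_const int_Gp])
        (use gal(2) in \<open>simp_all add: not_le[symmetric], meson less_eq_real_def linear\<close>)
    then have "0 \<le> Rem p F G"
      by (simp add: Rem[OF p])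
    \<comment> \<open>Here \<open>F\<close> is compared with \<open>p\<close>: to the left of
      \<open>q F p\<close> one has \<open>F x < p\<close>, to its right
      \<open>p \<le> F x\<close>.\<close>
    moreover have "Rem p F G \<le> (LBINT x=q G p..q F p. G x - F x)"
      unfolding Rem[OF p]
      by (rule interval_integral_le_signed[OF int_Gp int_diff])
        (use gal(1) in \<open>simp_all add: not_le[symmetric], meson less_eq_real_def linear\<close>)
    moreover have "(LBINT x=q G p..q F p. G x - F x)
        \<le> \<bar>q G p - q F p\<bar> * (SUP x::real. \<bar>G x - F x\<bar>)"
    proof -
      define S where "S = (SUP x::real. \<bar>G x - F x\<bar>)"
      have S: "\<bar>G x - F x\<bar> \<le> S" for x
        unfolding S_def by (rule cSUP_upper) (use diff_le in \<open>auto intro!: bdd_aboveI2\<close>)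
      \<comment> \<open>On a reversed interval a lower bound for the integrand is required, hence
        \<open>- S\<close>. In both cases the oriented integral of \<open>s\<close> is
        \<open>\<bar>q G p - q F p\<bar> * S\<close>.\<close>
      define s where "s = (if q G p \<le> q F p then S else - S)"
      have "(LBINT x=q G p..q F p. G x - F x) \<le> (LBINT x=q G p..q F p. s)"
      proof (rule interval_integral_le_signed[OF int_diff int_const])
        show "G x - F x \<le> s" if "q G p < x" "x < q F p" for x
          using that S[of x] by (simp add: s_def)
        show "s \<le> G x - F x" if "q F p < x" "x < q G p" for x
          using that S[of x] by (simp add: s_def)
      qed
      also have "\<dots> = \<bar>q G p - q F p\<bar> * S"
        by (simp add: s_def interval_integral_const algebra_simps)
      finally show ?thesis unfolding S_def .
    qed
    ultimately show ?thesis
      using assms(4,5) p by (simp add: quantile)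
  qed
  ultimately show ?thesis by blast
qed

end
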